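(* Suppose $E$ is a computably enumerable equivalence relation on $\mathbb{N}$ all of whose equivalence classes are infinite. Then $E$ is computably graphable by a computable graph of diameter $2$.
   Context: A ceer $E$ is computably graphable if there is a computable (undirected, simple) graph $G$ on $\mathbb{N}$ whose connectedness relation ($x,y$ related iff joined by a finite path in $G$) equals $E$. The diameter of a graph is the maximum distance between two connected vertices. *)

theory Defs
  imports Main "HOL-Library.Nat_Bijection" "HOL-Library.Extended_Nat"
begin

text \<open>Computability is rendered by the partial recursive functions. Programs carry no explicit
  arity: the arity is the length of the argument list. Projections count from \<open>0\<close>, and the
  recursion and minimisation variable is the head of the list.\<close>

datatype recf =
    Zero
  | Succ
  | Proj nat
  | Comp recf "recf list"
  | PrimRec recf recf
  | Mu recf

inductive reval :: "recf \<Rightarrow> nat list \<Rightarrow> nat \<Rightarrow> bool" where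
  reval_Zero: "reval Zero xs 0"
| reval_Succ: "reval Succ [x] (Suc x)"
| reval_Proj: "i < length xs \<Longrightarrow> reval (Proj i) xs (xs ! i)"
| reval_Comp: "length ys = length gs \<Longrightarrow> (\<forall>i<length gs. reval (gs ! i) xs (ys ! i)) \<Longrightarrow>
    reval f ys v \<Longrightarrow> reval (Comp f gs) xs v"
| reval_PrimRec_0: "reval f xs v \<Longrightarrow> reval (PrimRec f g) (0 # xs) v"
| reval_PrimRec_Suc: "reval (PrimRec f g) (n # xs) u \<Longrightarrow> reval g (n # u # xs) v \<Longrightarrow>
    reval (PrimRec f g) (Suc n # xs) v"
| reval_Mu: "reval f (n # xs) 0 \<Longrightarrow> (\<forall>m<n. \<exists>k. reval f (m # xs) (Suc k)) \<Longrightarrow>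
    reval (Mu f) xs n"

inductive_cases reval_ZeroE: "reval Zero xs v"
inductive_cases reval_SuccE: "reval Succ xs v"
inductive_cases reval_ProjE: "reval (Proj i) xs v"
inductive_cases reval_CompE: "reval (Comp f gs) xs v"
inductive_cases reval_PrimRec_0E: "reval (PrimRec f g) (0 # xs) v"
inductive_cases reval_PrimRec_SucE: "reval (PrimRec f g) (Suc n # xs) v"
inductive_cases reval_MuE: "reval (Mu f) xs v"

lemma reval_deterministic:
  "reval p xs v \<Longrightarrow> reval p xs w \<Longrightarrow> v = w"
proof (induction arbitrary: w rule: reval.induct)
  case (reval_Zero xs)
  then show ?case by (auto elim: reval_ZeroE)
next
  case (reval_Succ x)
  then show ?case by (auto elim: reval_SuccE)
next
  case (reval_Proj i xs)
  from reval_Proj.prems show ?case by (rule reval_ProjE) simp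
next
  case (reval_Comp ys gs xs f v)
  from reval_Comp.prems obtain zs where zs: "length zs = length gs"
    "\<forall>i<length gs. reval (gs ! i) xs (zs ! i)" "reval f zs w"
    by (rule reval_CompE)
  have "ys ! i = zs ! i" if "i < length gs" for i
    using reval_Comp.IH(1) zs(2) that by blast
  then have "ys = zs"
    using reval_Comp.hyps zs(1) by (simp add: nth_equalityI)
  then show ?case
    using reval_Comp.IH(2) zs(3) by simp
next
  case (reval_PrimRec_0 f xs v g)
  from reval_PrimRec_0.prems have "reval f xs w" by (rule reval_PrimRec_0E)
  then show ?case by (rule reval_PrimRec_0.IH)
next
  case (reval_PrimRec_Suc f g n xs u v)
  from reval_PrimRec_Suc.prems obtain u'
    where u': "reval (PrimRec f g) (n # xs) u'" "reval g (n # u' # xs) w"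
    by (rule reval_PrimRec_SucE)
  have "u = u'" using u'(1) by (rule reval_PrimRec_Suc.IH(1))
  then show ?case using u'(2) reval_PrimRec_Suc.IH(2) by simp
next
  case (reval_Mu f n xs)
  from reval_Mu.prems
  have w: "reval f (w # xs) 0" "\<forall>m<w. \<exists>k. reval f (m # xs) (Suc k)"
    by (auto elim: reval_MuE)
  have "\<not> n < w" using w(2) reval_Mu.IH(1) by blast
  moreover have "\<not> w < n" using w(1) reval_Mu.IH(2) by blast
  ultimately show ?case by simp
qed

definition computable_fun :: "(nat \<Rightarrow> nat) \<Rightarrow> bool" where
  "computable_fun f \<longleftrightarrow> (\<exists>p. \<forall>x y. reval p [x] y \<longleftrightarrow> y = f x)"

definition computable_set :: "nat set \<Rightarrow> bool" where
  "computable_set A \<longleftrightarrow> computable_fun (\<lambda>x. if x \<in> A then 1 else 0)"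

definition ce_set :: "nat set \<Rightarrow> bool" where
  "ce_set A \<longleftrightarrow> A = {} \<or> (\<exists>f. computable_fun f \<and> A = range f)"

text \<open>Binary relations are identified with sets of numbers through the Cantor pairing function.\<close>

definition computable_rel :: "(nat \<times> nat) set \<Rightarrow> bool" where
  "computable_rel R \<longleftrightarrow> computable_set (prod_encode ` R)"

definition ce_rel :: "(nat \<times> nat) set \<Rightarrow> bool" where
  "ce_rel R \<longleftrightarrow> ce_set (prod_encode ` R)"

definition ceer :: "(nat \<times> nat) set \<Rightarrow> bool" where
  "ceer E \<longleftrightarrow> equiv UNIV E \<and> ce_rel E"

text \<open>A simple undirected graph with vertex set \<open>UNIV\<close> is given by its adjacency relation.\<close>

definition simple_graph :: "('a \<times> 'a) set \<Rightarrow> bool" where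
  "simple_graph G \<longleftrightarrow> sym G \<and> irrefl G"

definition connectedness :: "('a \<times> 'a) set \<Rightarrow> ('a \<times> 'a) set" where
  "connectedness G = {(x, y). \<exists>n. (x, y) \<in> G ^^ n}"

text \<open>Only meaningful for connected vertices.\<close>

definition graph_dist :: "('a \<times> 'a) set \<Rightarrow> 'a \<Rightarrow> 'a \<Rightarrow> nat" where
  "graph_dist G x y = (LEAST n. (x, y) \<in> G ^^ n)"

text \<open>The value is \<open>\<infinity>\<close> when distances are unbounded; a finite value is attained.\<close>

definition graph_diameter :: "('a \<times> 'a) set \<Rightarrow> enat" where
  "graph_diameter G = (SUP (x, y) \<in> connectedness G. enat (graph_dist G x y))"

definition computable_graphing :: "(nat \<times> nat) set \<Rightarrow> (nat \<times> nat) set \<Rightarrow> bool" where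
  "computable_graphing G E \<longleftrightarrow> simple_graph G \<and> computable_rel G \<and> connectedness G = E"

end

theory Submission imports Defs
begin

text \<open>Enumerate \<open>E\<close> as the pairs \<open>(a n, b n)\<close>. The least partner of \<open>x\<close> enumerated before stage
  \<open>n\<close> is a guess at the least element of the class of \<open>x\<close>; equivalent points eventually share the
  correct guess forever. For \<open>x < z\<close>, wait for the first stage \<open>n\<close> at which some \<open>a n \<ge> z\<close> is paired
  with the current guess for \<open>x\<close>, which happens because the class is infinite, and join \<open>x\<close> to \<open>z\<close>
  iff \<open>a n = z\<close>. The neighbours of \<open>x\<close> above \<open>x\<close> are thus the successive records among the
  elements seen to be equivalent to \<open>x\<close>, and two equivalent points have the same records from
  some stage on, hence arbitrarily large common neighbours. Allowing only edges whose larger endpoint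
  exceeds some \<open>q > 0\<close> equivalent to \<open>0\<close> leaves \<open>0\<close> and \<open>q\<close> at distance exactly \<open>2\<close>.\<close>

section \<open>Total recursive functions on argument lists\<close>

text \<open>Arguments form a single list, as in \<open>reval\<close>, so that each closure property
  is stated once for all arities. Producing the right value suffices, since
  \<open>reval_deterministic\<close> excludes any other; this recovers the equivalence demanded by
  \<open>computable_fun\<close>.\<close>

definition total_recursive :: "nat \<Rightarrow> (nat list \<Rightarrow> nat) \<Rightarrow> bool" where
  "total_recursive k F \<longleftrightarrow> (\<exists>p. \<forall>xs. length xs = k \<longrightarrow> reval p xs (F xs))"

lemma computable_fun_iff_total_recursive:
  "computable_fun f \<longleftrightarrow> total_recursive 1 (\<lambda>xs. f (xs ! 0))"
proof
  assume "computable_fun f"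
  then obtain p where "\<forall>x. reval p [x] (f x)"
    unfolding computable_fun_def by blast
  then show "total_recursive 1 (\<lambda>xs. f (xs ! 0))"
    unfolding total_recursive_def by (auto simp: length_Suc_conv intro!: exI[of _ p])
next
  assume "total_recursive 1 (\<lambda>xs. f (xs ! 0))"
  then obtain p where p: "\<And>xs. length xs = 1 \<Longrightarrow> reval p xs (f (xs ! 0))"
    unfolding total_recursive_def by blast
  have "reval p [x] (f x)" for x
    using p[of "[x]"] by simp
  then show "computable_fun f"
    unfolding computable_fun_def by (blast intro: reval_deterministic)
qed

lemma total_recursive_cong:
  assumes "total_recursive k F" and "\<And>xs. length xs = k \<Longrightarrow> F xs = G xs"
  shows "total_recursive k G"
  using assms unfolding total_recursive_def by metis

lemma total_recursive_nth: "i < k \<Longrightarrow> total_recursive k (\<lambda>xs. xs ! i)"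
  unfolding total_recursive_def by (metis reval_Proj)

lemma total_recursive_comp:
  assumes "total_recursive (length gs) F" and "\<And>g. g \<in> set gs \<Longrightarrow> total_recursive k g"
  shows "total_recursive k (\<lambda>xs. F (map (\<lambda>g. g xs) gs))"
proof -
  obtain p where p: "\<And>xs. length xs = length gs \<Longrightarrow> reval p xs (F xs)"
    using assms(1) unfolding total_recursive_def by blast
  obtain c where c: "\<And>g xs. g \<in> set gs \<Longrightarrow> length xs = k \<Longrightarrow> reval (c g) xs (g xs)"
    using assms(2) unfolding total_recursive_def by metis
  have "reval (Comp p (map c gs)) xs (F (map (\<lambda>g. g xs) gs))" if "length xs = k" for xs
    by (rule reval_Comp[of "map (\<lambda>g. g xs) gs"]) (auto intro: p c that)
  then show ?thesis
    unfolding total_recursive_def by blast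
qed

lemma total_recursive_comp1:
  assumes "total_recursive 1 (\<lambda>xs. f (xs ! 0))" and "total_recursive k g"
  shows "total_recursive k (\<lambda>xs. f (g xs))"
  using total_recursive_comp[of "[g]" "\<lambda>xs. f (xs ! 0)" k] assms by simp

lemma total_recursive_comp2:
  assumes "total_recursive 2 (\<lambda>xs. f (xs ! 0) (xs ! 1))"
    and "total_recursive k g" and "total_recursive k h"
  shows "total_recursive k (\<lambda>xs. f (g xs) (h xs))"
  using total_recursive_comp[of "[g, h]" "\<lambda>xs. f (xs ! 0) (xs ! 1)" k] assms
  by (auto simp: numeral_2_eq_2)

lemma total_recursive_Suc:
  assumes "total_recursive k g"
  shows "total_recursive k (\<lambda>xs. Suc (g xs))"
proof -
  have "total_recursive 1 (\<lambda>xs. Suc (xs ! 0))"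
    unfolding total_recursive_def by (auto simp: length_Suc_conv intro!: exI[of _ Succ] reval_Succ)
  then show ?thesis
    using assms by (rule total_recursive_comp1)
qed

lemma total_recursive_const: "total_recursive k (\<lambda>xs. c)"
proof (induction c)
  case 0
  show ?case
    unfolding total_recursive_def by (blast intro: reval_Zero)
qed (rule total_recursive_Suc)

text \<open>Turns \<open>PrimRec\<close> into HOL's \<open>rec_nat\<close>. \<open>G\<close> takes
  counter, previous value and parameters separately, matching the order in which
  \<open>PrimRec\<close> passes them.\<close>

lemma total_recursive_rec_nat:
  assumes "total_recursive k F"
    and "total_recursive (Suc (Suc k)) (\<lambda>ys. G (ys ! 0) (ys ! 1) (drop 2 ys))"
  shows "total_recursive (Suc k) (\<lambda>ys. rec_nat (F (tl ys)) (\<lambda>n u. G n u (tl ys)) (ys ! 0))"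
proof -
  obtain p where p: "\<And>xs. length xs = k \<Longrightarrow> reval p xs (F xs)"
    using assms(1) unfolding total_recursive_def by blast
  obtain q where q: "\<And>ys. length ys = Suc (Suc k) \<Longrightarrow> reval q ys (G (ys ! 0) (ys ! 1) (drop 2 ys))"
    using assms(2) unfolding total_recursive_def by blast
  have "reval (PrimRec p q) (n # xs) (rec_nat (F xs) (\<lambda>n u. G n u xs) n)" if "length xs = k" for n xs
  proof (induction n)
    case 0
    then show ?case
      by (auto intro: reval_PrimRec_0 p that)
  next
    case (Suc n)
    then show ?case
      using q[of "n # rec_nat (F xs) (\<lambda>n u. G n u xs) n # xs"] that
      by (auto intro: reval_PrimRec_Suc)
  qed
  then show ?thesis
    unfolding total_recursive_def by (auto simp: length_Suc_conv intro!: exI[of _ "PrimRec p q"])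
qed

lemma total_recursive_Least:
  assumes "total_recursive (Suc k) (\<lambda>ys. of_bool (P (ys ! 0) (tl ys)))"
    and ex: "\<And>xs. length xs = k \<Longrightarrow> \<exists>n. P n xs"
  shows "total_recursive k (\<lambda>xs. LEAST n. P n xs)"
proof -
  obtain p where p: "\<And>ys. length ys = Suc k \<Longrightarrow> reval p ys (of_bool (P (ys ! 0) (tl ys)))"
    using assms(1) unfolding total_recursive_def by blast
  \<comment> \<open>\<open>Mu\<close> looks for a zero, whereas a true \<open>P\<close> has value 1.
    The program \<open>c\<close> swaps the truth values; a false \<open>P\<close> then yields
    \<open>Suc 0\<close>, as \<open>reval_Mu\<close> requires below the minimum.\<close>
  obtain c where c': "\<And>xs. length xs = 1 \<Longrightarrow> reval c xs (1 - xs ! 0)"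
  proof -
    have "total_recursive (Suc 0) (\<lambda>ys. rec_nat 1 (\<lambda>n u. 0) (ys ! 0))"
      by (intro total_recursive_rec_nat[where F = "\<lambda>xs. 1" and G = "\<lambda>n u xs. 0"]
          total_recursive_const)
    moreover have "rec_nat 1 (\<lambda>n u. 0) x = 1 - x" for x :: nat
      by (cases x) auto
    ultimately show thesis
      using that unfolding total_recursive_def by auto
  qed
  have c: "reval c [x] (1 - x)" for x
    using c'[of "[x]"] by simp
  have np: "reval (Comp c [p]) (n # xs) (of_bool (\<not> P n xs))" if "length xs = k" for n xs
    by (rule reval_Comp[of "[of_bool (P n xs)]"])
      (use p[of "n # xs"] c[of "of_bool (P n xs)"] that in auto)
  have "reval (Mu (Comp c [p])) xs (LEAST n. P n xs)" if len: "length xs = k" for xs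
  proof (rule reval_Mu)
    show "reval (Comp c [p]) ((LEAST n. P n xs) # xs) 0"
      using np[OF len, of "LEAST n. P n xs"] LeastI_ex[OF ex[OF len]] by simp
    show "\<forall>m < LEAST n. P n xs. \<exists>k. reval (Comp c [p]) (m # xs) (Suc k)"
    proof (intro allI impI)
      fix m
      assume "m < (LEAST n. P n xs)"
      then have "\<not> P m xs"
        by (rule not_less_Least)
      then show "\<exists>k. reval (Comp c [p]) (m # xs) (Suc k)"
        using np[OF len, of m] by auto
    qed
  qed
  then show ?thesis
    unfolding total_recursive_def by blast
qed

section \<open>Arithmetic, decisions and the inverse of the pairing function\<close>

lemma total_recursive_add:
  assumes "total_recursive k f" and "total_recursive k g"
  shows "total_recursive k (\<lambda>xs. f xs + g xs)"
proof (rule total_recursive_comp2[OF _ assms])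
  have "total_recursive (Suc 1) (\<lambda>ys. rec_nat (tl ys ! 0) (\<lambda>n u. Suc u) (ys ! 0))"
    by (intro total_recursive_rec_nat[where F = "\<lambda>xs. xs ! 0" and G = "\<lambda>n u xs. Suc u"]
        total_recursive_nth total_recursive_Suc) auto
  moreover have "rec_nat y (\<lambda>n u. Suc u) x = x + y" for x y
    by (induction x) auto
  ultimately show "total_recursive 2 (\<lambda>xs. xs ! 0 + xs ! 1)"
    by (auto elim!: total_recursive_cong simp: numeral_2_eq_2 nth_tl)
qed

lemma total_recursive_mult:
  assumes "total_recursive k f" and "total_recursive k g"
  shows "total_recursive k (\<lambda>xs. f xs * g xs)"
proof (rule total_recursive_comp2[OF _ assms])
  have "total_recursive (Suc (Suc 1)) (\<lambda>ys. ys ! 1 + drop 2 ys ! 0)"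
    by (rule total_recursive_cong[OF total_recursive_add[OF
            total_recursive_nth[of 1] total_recursive_nth[of 2]]]) auto
  then have "total_recursive (Suc 1) (\<lambda>ys. rec_nat 0 (\<lambda>n u. u + tl ys ! 0) (ys ! 0))"
    by (intro total_recursive_rec_nat[where F = "\<lambda>xs. 0" and G = "\<lambda>n u xs. u + xs ! 0"]
        total_recursive_const)
  moreover have "rec_nat 0 (\<lambda>n u. u + y) x = x * y" for x y :: nat
    by (induction x) auto
  ultimately show "total_recursive 2 (\<lambda>xs. xs ! 0 * xs ! 1)"
    by (auto elim!: total_recursive_cong simp: numeral_2_eq_2 nth_tl)
qed

lemma total_recursive_diff:
  assumes "total_recursive k f" and "total_recursive k g"
  shows "total_recursive k (\<lambda>xs. f xs - g xs)"
\<comment> \<open>The arguments are swapped: truncated subtraction recurses on the subtrahend, and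
  the recursion variable must be the head of the list.\<close>
proof (rule total_recursive_comp2[OF _ assms(2) assms(1)])
  have "total_recursive (Suc 0) (\<lambda>ys. rec_nat 0 (\<lambda>n u. n) (ys ! 0))"
    by (intro total_recursive_rec_nat[where F = "\<lambda>xs. 0" and G = "\<lambda>n u xs. n"]
        total_recursive_const total_recursive_nth) auto
  moreover have "rec_nat 0 (\<lambda>n u. n) x = x - 1" for x
    by (cases x) auto
  ultimately have pred: "total_recursive 1 (\<lambda>ys. ys ! 0 - 1)"
    by simp
  have "total_recursive (Suc 1) (\<lambda>ys. rec_nat (tl ys ! 0) (\<lambda>n u. u - 1) (ys ! 0))"
    by (intro total_recursive_rec_nat[where F = "\<lambda>xs. xs ! 0" and G = "\<lambda>n u xs. u - 1"]
        total_recursive_nth total_recursive_comp1[OF pred]) auto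
  moreover have "rec_nat y (\<lambda>n u. u - 1) x = y - x" for x y
    by (induction x) auto
  ultimately show "total_recursive 2 (\<lambda>xs. xs ! 1 - xs ! 0)"
    by (auto elim!: total_recursive_cong simp: numeral_2_eq_2 nth_tl)
qed

lemma total_recursive_le:
  assumes "total_recursive k f" and "total_recursive k g"
  shows "total_recursive k (\<lambda>xs. of_bool (f xs \<le> g xs))"
  by (rule total_recursive_cong[of _ "\<lambda>xs. 1 - (f xs - g xs)"])
    (intro total_recursive_diff total_recursive_const assms, auto)

lemma total_recursive_conj:
  assumes "total_recursive k (\<lambda>xs. of_bool (P xs))" and "total_recursive k (\<lambda>xs. of_bool (Q xs))"
  shows "total_recursive k (\<lambda>xs. of_bool (P xs \<and> Q xs))"
  by (rule total_recursive_cong[OF total_recursive_mult[OF assms]]) auto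

lemma total_recursive_less:
  assumes "total_recursive k f" and "total_recursive k g"
  shows "total_recursive k (\<lambda>xs. of_bool (f xs < g xs))"
  unfolding less_eq_Suc_le by (intro total_recursive_le total_recursive_Suc assms)

lemma total_recursive_eq:
  assumes "total_recursive k f" and "total_recursive k g"
  shows "total_recursive k (\<lambda>xs. of_bool (f xs = g xs))"
  unfolding order_eq_iff by (intro total_recursive_conj total_recursive_le assms)

lemma total_recursive_if:
  assumes "total_recursive k (\<lambda>xs. of_bool (P xs))" and "total_recursive k f" and "total_recursive k g"
  shows "total_recursive k (\<lambda>xs. if P xs then f xs else g xs)"
  by (rule total_recursive_cong[of _ "\<lambda>xs. of_bool (P xs) * f xs + (1 - of_bool (P xs)) * g xs"])
    (auto intro!: total_recursive_add total_recursive_mult total_recursive_diff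
      total_recursive_const assms)

lemmas total_recursive_intros =
  total_recursive_const total_recursive_Suc total_recursive_add total_recursive_mult
  total_recursive_diff total_recursive_le total_recursive_less total_recursive_eq
  total_recursive_conj total_recursive_if

lemma total_recursive_min:
  assumes "total_recursive k f" and "total_recursive k g"
  shows "total_recursive k (\<lambda>xs. min (f xs) (g xs))"
  unfolding min_def by (intro total_recursive_intros assms)

lemma total_recursive_max:
  assumes "total_recursive k f" and "total_recursive k g"
  shows "total_recursive k (\<lambda>xs. max (f xs) (g xs))"
  unfolding max_def by (intro total_recursive_intros assms)

lemma total_recursive_triangle:
  assumes "total_recursive k f"
  shows "total_recursive k (\<lambda>xs. triangle (f xs))"
proof (rule total_recursive_comp1[OF _ assms])
  have "total_recursive (Suc 0) (\<lambda>ys. rec_nat 0 (\<lambda>n u. u + Suc n) (ys ! 0))"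
    by (intro total_recursive_rec_nat[where F = "\<lambda>xs. 0" and G = "\<lambda>n u xs. u + Suc n"]
        total_recursive_intros total_recursive_nth) auto
  moreover have "rec_nat 0 (\<lambda>n u. u + Suc n) x = triangle x" for x
    by (induction x) auto
  ultimately show "total_recursive 1 (\<lambda>xs. triangle (xs ! 0))"
    by simp
qed

text \<open>The code of \<open>(x, y)\<close> is \<open>triangle (x + y) + x\<close>, which lies in
  the interval from \<open>triangle (x + y)\<close> up to but excluding
  \<open>triangle (Suc (x + y))\<close>. Hence the diagonal can be found by minimisation.\<close>

lemma diagonal_eq_Least:
  "fst (prod_decode e) + snd (prod_decode e) = (LEAST d. e < triangle (Suc d))"
proof -
  obtain x y where e: "e = prod_encode (x, y)"
    by (metis prod.exhaust prod_decode_inverse)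
  have mono: "triangle i \<le> triangle j" if "i \<le> j" for i j
    using that by (induction rule: dec_induct) auto
  have "(LEAST d. e < triangle (Suc d)) = x + y"
  proof (rule Least_equality)
    show "e < triangle (Suc (x + y))"
      by (simp add: e prod_encode_def)
    show "x + y \<le> d" if "e < triangle (Suc d)" for d
      using that mono[of "Suc d" "x + y"] by (force simp: e prod_encode_def not_less)
  qed
  then show ?thesis
    by (simp add: e)
qed

lemma total_recursive_prod_decode:
  assumes "total_recursive k f"
  shows "total_recursive k (\<lambda>xs. fst (prod_decode (f xs)))"
    and "total_recursive k (\<lambda>xs. snd (prod_decode (f xs)))"
proof -
  define D where "D e = fst (prod_decode e) + snd (prod_decode e)" for e
  have "total_recursive 1 (\<lambda>xs. LEAST d. xs ! 0 < triangle (Suc d))"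
  proof (rule total_recursive_Least)
    have "total_recursive (Suc 1) (\<lambda>ys. of_bool (ys ! 1 < triangle (Suc (ys ! 0))))"
      by (intro total_recursive_intros total_recursive_triangle total_recursive_nth) auto
    then show "total_recursive (Suc 1) (\<lambda>ys. of_bool (tl ys ! 0 < triangle (Suc (ys ! 0))))"
      by (rule total_recursive_cong) (auto simp: nth_tl)
    show "\<exists>d. xs ! 0 < triangle (Suc d)" for xs :: "nat list"
      by (rule exI[of _ "xs ! 0"]) simp
  qed
  then have "total_recursive 1 (\<lambda>xs. D (xs ! 0))"
    by (simp add: D_def diagonal_eq_Least)
  then have D: "total_recursive k (\<lambda>xs. D (f xs))"
    using assms by (rule total_recursive_comp1)
  \<comment> \<open>Once the diagonal is known, the first component is the offset of the code on it,
    and the second is the diagonal minus the first.\<close>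
  have "fst (prod_decode e) = e - triangle (D e)" for e
  proof -
    have "e = prod_encode (fst (prod_decode e), snd (prod_decode e))"
      by simp
    then have "e = triangle (D e) + fst (prod_decode e)"
      unfolding prod_encode_def D_def case_prod_conv .
    then show ?thesis
      by linarith
  qed
  then show fst: "total_recursive k (\<lambda>xs. fst (prod_decode (f xs)))"
    by (simp only:) (intro total_recursive_diff total_recursive_triangle assms D)
  show "total_recursive k (\<lambda>xs. snd (prod_decode (f xs)))"
    using total_recursive_diff[OF D fst] by (simp add: D_def)
qed

section \<open>Records of an enumerated equivalence relation\<close>

text \<open>Starting from \<open>x\<close> itself keeps the guess in the class of \<open>x\<close>
  even before any pair with first component \<open>x\<close> has appeared.\<close>

primrec least_partner :: "(nat \<Rightarrow> nat) \<Rightarrow> (nat \<Rightarrow> nat) \<Rightarrow> nat \<Rightarrow> nat \<Rightarrow> nat" where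
  "least_partner a b 0 x = x"
| "least_partner a b (Suc n) x =
    (if a n = x then min (least_partner a b n x) (b n) else least_partner a b n x)"

text \<open>Asking for \<open>z \<le> a n\<close> instead of equality lets the search succeed
  whether or not \<open>z\<close> is equivalent to \<open>x\<close>, provided that the classes are
  infinite; this makes adjacency decidable.\<close>

definition record_stage :: "(nat \<Rightarrow> nat) \<Rightarrow> (nat \<Rightarrow> nat) \<Rightarrow> nat \<Rightarrow> nat \<Rightarrow> nat" where
  "record_stage a b x z = (LEAST n. z \<le> a n \<and> b n = least_partner a b n x)"

definition record_graph :: "(nat \<Rightarrow> nat) \<Rightarrow> (nat \<Rightarrow> nat) \<Rightarrow> nat \<Rightarrow> (nat \<times> nat) set" where
  "record_graph a b q =
    {(x, y). x \<noteq> y \<and> q < max x y \<and> a (record_stage a b (min x y) (max x y)) = max x y}"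

lemma simple_graph_record_graph: "simple_graph (record_graph a b q)"
  by (auto simp: simple_graph_def record_graph_def sym_def irrefl_def min.commute max.commute)

section \<open>Computability of the record graph\<close>

lemma total_recursive_least_partner:
  assumes "computable_fun a" and "computable_fun b"
  shows "total_recursive 2 (\<lambda>xs. least_partner a b (xs ! 0) (xs ! 1))"
proof -
  note ab = assms[unfolded computable_fun_iff_total_recursive, THEN total_recursive_comp1]
  have "total_recursive (Suc (Suc 1))
      (\<lambda>ys. if a (ys ! 0) = ys ! 2 then min (ys ! 1) (b (ys ! 0)) else ys ! 1)"
    by (intro total_recursive_intros total_recursive_min ab total_recursive_nth) auto
  then have "total_recursive (Suc (Suc 1))
      (\<lambda>ys. if a (ys ! 0) = drop 2 ys ! 0 then min (ys ! 1) (b (ys ! 0)) else ys ! 1)"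
    by (rule total_recursive_cong) auto
  then have "total_recursive (Suc 1) (\<lambda>ys. rec_nat (tl ys ! 0)
      (\<lambda>n u. if a n = tl ys ! 0 then min u (b n) else u) (ys ! 0))"
    by (intro total_recursive_rec_nat[where F = "\<lambda>xs. xs ! 0" and
          G = "\<lambda>n u xs. if a n = xs ! 0 then min u (b n) else u"] total_recursive_nth) auto
  moreover have "rec_nat x (\<lambda>n u. if a n = x then min u (b n) else u) n = least_partner a b n x"
    for n x
    by (induction n) auto
  ultimately show ?thesis
    by (auto elim!: total_recursive_cong simp: numeral_2_eq_2 nth_tl)
qed

lemma total_recursive_record_stage:
  assumes "computable_fun a" and "computable_fun b"
    and "\<And>x z. \<exists>n. z \<le> a n \<and> b n = least_partner a b n x"
  shows "total_recursive 2 (\<lambda>xs. record_stage a b (xs ! 0) (xs ! 1))"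
  unfolding record_stage_def
proof (rule total_recursive_Least)
  note ab = assms(1,2)[unfolded computable_fun_iff_total_recursive, THEN total_recursive_comp1]
  note lp = total_recursive_comp2[OF total_recursive_least_partner[OF assms(1,2)]]
  have "total_recursive (Suc 2)
      (\<lambda>ys. of_bool (ys ! 2 \<le> a (ys ! 0) \<and> b (ys ! 0) = least_partner a b (ys ! 0) (ys ! 1)))"
    by (intro total_recursive_intros lp ab total_recursive_nth) auto
  then show "total_recursive (Suc 2) (\<lambda>ys. of_bool (tl ys ! 1 \<le> a (ys ! 0) \<and>
      b (ys ! 0) = least_partner a b (ys ! 0) (tl ys ! 0)))"
    by (rule total_recursive_cong) (auto simp: nth_tl numeral_2_eq_2)
qed (rule assms(3))

lemma computable_rel_record_graph:
  assumes "computable_fun a" and "computable_fun b"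
    and "\<And>x z. \<exists>n. z \<le> a n \<and> b n = least_partner a b n x"
  shows "computable_rel (record_graph a b q)"
proof -
  note a = assms(1)[unfolded computable_fun_iff_total_recursive, THEN total_recursive_comp1]
  note rs = total_recursive_comp2[OF total_recursive_record_stage[OF assms]]
  define l where "l e = min (fst (prod_decode e)) (snd (prod_decode e))" for e
  define h where "h e = max (fst (prod_decode e)) (snd (prod_decode e))" for e
  have l: "total_recursive 1 (\<lambda>xs. l (xs ! 0))" and h: "total_recursive 1 (\<lambda>xs. h (xs ! 0))"
    unfolding l_def h_def
    by (intro total_recursive_min total_recursive_max total_recursive_prod_decode
        total_recursive_nth; simp)+
  have "total_recursive 1 (\<lambda>xs. of_bool (l (xs ! 0) < h (xs ! 0) \<and> q < h (xs ! 0) \<and>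
      a (record_stage a b (l (xs ! 0)) (h (xs ! 0))) = h (xs ! 0)))"
    by (intro total_recursive_intros a rs l h)
  \<comment> \<open>Every number codes exactly one pair, so membership is tested on the decoded
    components; their being distinct becomes \<open>l e < h e\<close>.\<close>
  moreover have "e \<in> prod_encode ` record_graph a b q \<longleftrightarrow>
      l e < h e \<and> q < h e \<and> a (record_stage a b (l e) (h e)) = h e" for e
  proof -
    have "e \<in> prod_encode ` record_graph a b q \<longleftrightarrow> prod_decode e \<in> record_graph a b q"
      by (metis (no_types) image_iff prod_decode_inverse prod_encode_inverse)
    also have "\<dots> \<longleftrightarrow> l e < h e \<and> q < h e \<and> a (record_stage a b (l e) (h e)) = h e"
      unfolding record_graph_def l_def h_def by (cases "prod_decode e") auto
    finally show ?thesis .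
  qed
  ultimately show ?thesis
    unfolding computable_rel_def computable_set_def computable_fun_iff_total_recursive
    by (simp add: of_bool_def)
qed

section \<open>Guesses and searches along an enumeration with infinite classes\<close>

locale enumerated_equivalence =
  fixes E :: "(nat \<times> nat) set" and a b :: "nat \<Rightarrow> nat"
  assumes equiv_E: "equiv UNIV E"
    and infinite_classes: "\<And>C. C \<in> UNIV // E \<Longrightarrow> infinite C"
    and range_E: "range (\<lambda>n. (a n, b n)) = E"
begin

lemma E_refl: "(x, x) \<in> E"
  using equiv_E by (auto simp: equiv_def refl_on_def)

lemma E_sym: "(x, y) \<in> E \<Longrightarrow> (y, x) \<in> E"
  using equiv_E by (auto simp: equiv_def sym_def)

lemma E_trans: "(x, y) \<in> E \<Longrightarrow> (y, z) \<in> E \<Longrightarrow> (x, z) \<in> E"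
  using equiv_E by (auto simp: equiv_def trans_def)

lemma enumerated: "(a n, b n) \<in> E"
  using range_E by auto

lemma ex_stage: "(x, y) \<in> E \<Longrightarrow> \<exists>n. a n = x \<and> b n = y"
  by (auto simp flip: range_E)

lemma ex_larger_equivalent: "\<exists>y>k. (x, y) \<in> E"
proof -
  have "infinite (E `` {x})"
    by (rule infinite_classes) (simp add: quotientI)
  then show ?thesis
    by (auto simp: infinite_nat_iff_unbounded)
qed

lemma least_partner_equivalent: "(x, least_partner a b n x) \<in> E"
  by (induction n) (use enumerated in \<open>auto simp: E_refl min_def\<close>)

text \<open>The guess never leaves the class, so it cannot drop below the least element, and it
  reaches that element once the pair of \<open>x\<close> with it has been enumerated.\<close>

lemma least_partner_eventually_least:
  "\<exists>s. \<forall>n\<ge>s. least_partner a b n x = (LEAST w. (x, w) \<in> E)"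
proof -
  let ?m = "LEAST w. (x, w) \<in> E"
  have "(x, ?m) \<in> E"
    using E_refl by (rule LeastI)
  then obtain i where i: "a i = x" "b i = ?m"
    using ex_stage by blast
  \<comment> \<open>The bound is \<open>Suc i\<close> because the guess at stage \<open>n\<close>
    uses only pairs of index below \<open>n\<close>.\<close>
  have "least_partner a b n x \<le> ?m" if "Suc i \<le> n" for n
    using that by (induction rule: dec_induct) (use i in auto)
  moreover have "?m \<le> least_partner a b n x" for n
    using least_partner_equivalent by (rule Least_le)
  ultimately show ?thesis
    by (meson order_antisym)
qed

text \<open>Pair a large element \<open>u\<close> of the class with the true minimum. If
  \<open>u\<close> exceeds every earlier \<open>a i\<close>, this pair can appear only after the
  guess has settled on that minimum.\<close>

lemma ex_late_large_stage: "\<exists>n\<ge>s. z \<le> a n \<and> b n = least_partner a b n x"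
proof -
  let ?m = "LEAST w. (x, w) \<in> E"
  obtain t where t: "\<And>n. t \<le> n \<Longrightarrow> least_partner a b n x = ?m"
    using least_partner_eventually_least by blast
  \<comment> \<open>The sum dominates each \<open>a i\<close> with \<open>i < s + t\<close>, which
    forces the stage of \<open>u\<close> to be at least \<open>s + t\<close>.\<close>
  obtain u where u: "u > z + (\<Sum>i<s + t. a i)" "(x, u) \<in> E"
    using ex_larger_equivalent by blast
  have "(x, ?m) \<in> E"
    using E_refl by (rule LeastI)
  then have "(u, ?m) \<in> E"
    using u(2) by (blast intro: E_sym E_trans)
  then obtain n where n: "a n = u" "b n = ?m"
    using ex_stage by blast
  have "s + t \<le> n"
  proof (rule ccontr)
    assume "\<not> s + t \<le> n"
    then have "a n \<le> (\<Sum>i<s + t. a i)"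
      by (intro member_le_sum) auto
    then show False
      using u(1) n(1) by simp
  qed
  then show ?thesis
    using t[of n] u(1) n by (intro exI[of _ n]) auto
qed

lemma record_stage_props:
  "z \<le> a (record_stage a b x z)"
  "b (record_stage a b x z) = least_partner a b (record_stage a b x z) x"
proof -
  have "\<exists>n. z \<le> a n \<and> b n = least_partner a b n x"
    using ex_late_large_stage by blast
  from LeastI_ex[OF this] show "z \<le> a (record_stage a b x z)"
    "b (record_stage a b x z) = least_partner a b (record_stage a b x z) x"
    unfolding record_stage_def by auto
qed

section \<open>Connectedness and diameter of the record graph\<close>

lemma record_graph_subset: "record_graph a b q \<subseteq> E"
proof -
  \<comment> \<open>At the record stage, \<open>z\<close> is paired with the current guess for
    \<open>x\<close>, and that guess is itself equivalent to \<open>x\<close>.\<close>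
  have *: "(x, z) \<in> E" if "a (record_stage a b x z) = z" for x z
    using enumerated[of "record_stage a b x z"] that record_stage_props(2)[of x z]
      least_partner_equivalent E_sym E_trans by metis
  show ?thesis
  proof
    fix e
    assume "e \<in> record_graph a b q"
    then obtain x y where "e = (x, y)" and "(min x y, max x y) \<in> E"
      unfolding record_graph_def using * by blast
    then show "e \<in> E"
      using E_sym by (cases "x \<le> y") auto
  qed
qed

text \<open>A record of \<open>x\<close> beyond every first component listed before the guesses for
  \<open>x\<close> and \<open>y\<close> agree for good is a record of \<open>y\<close> too: stages
  early enough for the guesses to differ carry only small elements.\<close>

lemma ex_common_neighbour:
  assumes "(x, y) \<in> E"
  shows "\<exists>z. (x, z) \<in> record_graph a b q \<and> (z, y) \<in> record_graph a b q"
proof -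
  have "(x, w) \<in> E \<longleftrightarrow> (y, w) \<in> E" for w
    using assms E_sym E_trans by blast
  then obtain s t where "\<And>n. s \<le> n \<Longrightarrow> least_partner a b n x = (LEAST w. (x, w) \<in> E)"
    and "\<And>n. t \<le> n \<Longrightarrow> least_partner a b n y = (LEAST w. (x, w) \<in> E)"
    using least_partner_eventually_least[of x] least_partner_eventually_least[of y] by auto
  then have agree: "least_partner a b n x = least_partner a b n y" if "s + t \<le> n" for n
    using that by simp
  \<comment> \<open>The threshold lies above \<open>x\<close>, \<open>y\<close> and
    \<open>q\<close>, so that \<open>z\<close> is the larger endpoint of both edges and passes the
    cutoff; the sum puts it above all elements listed before stage \<open>s + t\<close>.\<close>
  define k where "k = Suc (x + y + q + (\<Sum>i<s + t. a i))"
  define n where "n = record_stage a b x k"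
  define z where "z = a n"
  have z: "k \<le> z"
    unfolding z_def n_def by (rule record_stage_props(1))
  have early: "a i < k" if "i < s + t" for i
  proof -
    have "a i \<le> (\<Sum>i<s + t. a i)"
      using that by (intro member_le_sum) auto
    then show ?thesis
      by (simp add: k_def)
  qed
  have late: "s + t \<le> n"
    using early[of n] z unfolding z_def by linarith
  have bn: "b n = least_partner a b n x"
    unfolding n_def by (rule record_stage_props(2))
  \<comment> \<open>Since \<open>k \<le> z\<close>, a stage that meets threshold \<open>z\<close>
    also meets \<open>k\<close>, so the minimality of \<open>n\<close> carries over to
    \<open>z\<close>.\<close>
  have least: "n \<le> i" if "z \<le> a i" "b i = least_partner a b i x" for i
    unfolding n_def record_stage_def by (rule Least_le) (use that z in auto)
  have "record_stage a b x z = n"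
    unfolding record_stage_def by (rule Least_equality) (use bn least in \<open>auto simp: z_def\<close>)
  moreover have "record_stage a b y z = n"
    unfolding record_stage_def
  proof (rule Least_equality)
    show "z \<le> a n \<and> b n = least_partner a b n y"
      using bn agree[OF late] by (simp add: z_def)
    \<comment> \<open>A competing stage before \<open>s + t\<close> is excluded by
      \<open>early\<close>; from \<open>s + t\<close> on the guesses coincide, so it competes for
      \<open>x\<close> as well.\<close>
    show "n \<le> i" if "z \<le> a i \<and> b i = least_partner a b i y" for i
      using that early[of i] z agree[of i] least[of i] by (cases "i < s + t") auto
  qed
  moreover have "x < z" "y < z" "q < z"
    using z by (auto simp: k_def)
  ultimately show ?thesis
    by (intro exI[of _ z]) (auto simp: record_graph_def z_def max_def min_def)
qed

text \<open>Walks stay inside \<open>E\<close> because every edge does; conversely, a common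
  neighbour gives a walk of length 2 between any two equivalent points, including from a point to
  itself.\<close>

lemma connectedness_record_graph: "connectedness (record_graph a b q) = E"
proof -
  let ?G = "record_graph a b q"
  have "(x, y) \<in> E" if "(x, y) \<in> ?G ^^ n" for n x y
    using that
  proof (induction n arbitrary: y)
    case (Suc n)
    then show ?case
      using record_graph_subset E_trans by fastforce
  qed (simp add: E_refl)
  moreover have "(x, y) \<in> ?G ^^ 2" if "(x, y) \<in> E" for x y
    using ex_common_neighbour[OF that] by (auto simp: numeral_2_eq_2)
  ultimately show ?thesis
    unfolding connectedness_def by blast
qed

lemma graph_diameter_record_graph:
  assumes "(0, q) \<in> E" and "0 < q"
  shows "graph_diameter (record_graph a b q) = 2"
proof -
  let ?G = "record_graph a b q"
  have two: "(x, y) \<in> ?G ^^ 2" if "(x, y) \<in> E" for x y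
    using ex_common_neighbour[OF that] by (auto simp: numeral_2_eq_2)
  have le: "graph_dist ?G x y \<le> 2" if "(x, y) \<in> E" for x y
    unfolding graph_dist_def using two[OF that] by (rule Least_le)
  have "(0, q) \<in> ?G ^^ graph_dist ?G 0 q"
    unfolding graph_dist_def using two[OF assms(1)] by (rule LeastI)
  \<comment> \<open>The cutoff is strict, so a pair whose larger endpoint is \<open>q\<close> is
    never an edge.\<close>
  moreover have "(0, q) \<notin> ?G ^^ 0" "(0, q) \<notin> ?G ^^ 1"
    using assms(2) by (auto simp: record_graph_def)
  ultimately have "graph_dist ?G 0 q \<noteq> 0" "graph_dist ?G 0 q \<noteq> 1"
    by metis+
  then have "graph_dist ?G 0 q = 2"
    using le[OF assms(1)] by linarith
  \<comment> \<open>The common neighbours bound the supremum by 2, and the pair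
    \<open>(0, q)\<close> attains this bound.\<close>
  then show ?thesis
    unfolding graph_diameter_def connectedness_record_graph
    by (intro antisym SUP_least SUP_upper2[OF assms(1)])
      (auto dest: le simp: numeral_eq_enat)
qed

end

theorem theorem7p2:
  fixes E :: "(nat \<times> nat) set"
  assumes "ceer E"
    and "\<forall>C \<in> UNIV // E. infinite C"
  shows "\<exists>G. computable_graphing G E \<and> graph_diameter G = 2"
proof -
  have equiv: "equiv UNIV E" and ce: "ce_set (prod_encode ` E)"
    using assms(1) by (auto simp: ceer_def ce_rel_def)
  \<comment> \<open>Reflexivity rules out the empty case of \<open>ce_set\<close>, leaving an
    enumerating function.\<close>
  then have "E \<noteq> {}"
    by (auto simp: equiv_def refl_on_def)
  then obtain f where f: "computable_fun f" "prod_encode ` E = range f"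
    using ce by (auto simp: ce_set_def)
  define a where "a n = fst (prod_decode (f n))" for n
  define b where "b n = snd (prod_decode (f n))" for n
  have "range (\<lambda>n. (a n, b n)) = prod_decode ` range f"
    by (auto simp: a_def b_def)
  also have "\<dots> = E"
    unfolding f(2)[symmetric] by (simp add: image_image)
  finally interpret enumerated_equivalence E a b
    using equiv assms(2) by unfold_locales auto
  have "computable_fun a" "computable_fun b"
    using f(1) unfolding computable_fun_iff_total_recursive a_def b_def
    by (rule total_recursive_prod_decode)+
  \<comment> \<open>A positive \<open>q\<close> exists because the class of 0 is infinite.\<close>
  moreover obtain q where "(0, q) \<in> E" "0 < q"
    using ex_larger_equivalent by blast
  moreover have "\<exists>n. z \<le> a n \<and> b n = least_partner a b n x" for x z
    using ex_late_large_stage by blast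
  ultimately show ?thesis
    unfolding computable_graphing_def
    using simple_graph_record_graph computable_rel_record_graph connectedness_record_graph
      graph_diameter_record_graph by blast
qed

end
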